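(* For every fixed $0<\epsilon<\frac12$, $$R^{\mathrm{oot}}_\epsilon(\mathrm{MAX}_n)\in O(\log n),\qquad R^{\mathrm{uni}}_\epsilon(\mathrm{MAX}_n)\in\Omega(n),$$ and the same asymptotic gap (up to multiplicative and additive constants) holds when only private coins are allowed.
   Context: $\mathrm{MAX}_n:\{0,1\}^n\times\{0,1\}^n\to\{0,1\}^n$ is $\mathrm{MAX}_n(x,y)=x$ if $x\ge y$ and $y$ otherwise, comparing strings as binary integers. Two-party communication with private randomness $r_A,r_B$, public randomness $r$, transcript $t_\pi$ (exchanged bits, public randomness excluded), cost = maximum number of bits exchanged. Output models with error $\epsilon$ (correct with probability at least $1-\epsilon$ on every input), output maps $O_A(t_\pi,r,r_A,x)$, $O_B(t_\pi,r,r_B,y)$: Alice (resp. Bob) model — $O_A=f(x,y)$ (resp. $O_B=f(x,y)$); one-out-of-two — values in $\{0,1\}^n\cup\{\top\}$ and $(O_A,O_B)\in\{(f(x,y),\top),(\top,f(x,y))\}$. $R^{\mathrm{oot}}_\epsilon$ is the minimum one-out-of-two cost and $R^{\mathrm{uni}}_\epsilon=\min(R^A_\epsilon,R^B_\epsilon)$, with public and private coins allowed (the private-coin versions restrict to private randomness only). Logarithms base 2. *)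

theory Defs
  imports "HOL-Probability.Probability" "HOL-Library.Extended_Nat" "HOL-Library.Landau_Symbols"
begin

type_synonym rand = "bool list"

text \<open>
  A protocol tree: at an inner node the owner (Alice or Bob) sends the bit computed from their
  private random string and their input, and the protocol continues in the left (bit 0) or
  right (bit 1) subtree.
\<close>

datatype ('x, 'y) ptree =
    Halt
  | Alice "rand \<Rightarrow> 'x \<Rightarrow> bool" "('x, 'y) ptree" "('x, 'y) ptree"
  | Bob "rand \<Rightarrow> 'y \<Rightarrow> bool" "('x, 'y) ptree" "('x, 'y) ptree"

primrec bits_sent :: "('x, 'y) ptree \<Rightarrow> rand \<Rightarrow> rand \<Rightarrow> 'x \<Rightarrow> 'y \<Rightarrow> bool list" where
  "bits_sent Halt rA rB x y = []"
| "bits_sent (Alice a t0 t1) rA rB x y =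
     (if a rA x then True # bits_sent t1 rA rB x y else False # bits_sent t0 rA rB x y)"
| "bits_sent (Bob b t0 t1) rA rB x y =
     (if b rB y then True # bits_sent t1 rA rB x y else False # bits_sent t0 rA rB x y)"

text \<open>
  The public random string selects the tree, so that messages, speakers and halting may depend
  on it. The three random strings are independent, each with an arbitrary distribution on
  finite bit strings.
\<close>

record ('x, 'y) protocol =
  pub :: "rand pmf"
  privA :: "rand pmf"
  privB :: "rand pmf"
  ptree :: "rand \<Rightarrow> ('x, 'y) ptree"

definition coins :: "('x, 'y) protocol \<Rightarrow> (rand \<times> rand \<times> rand) pmf" where
  "coins \<pi> = pair_pmf (pub \<pi>) (pair_pmf (privA \<pi>) (privB \<pi>))"

definition private_coin :: "('x, 'y) protocol \<Rightarrow> bool" where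
  "private_coin \<pi> \<longleftrightarrow> pub \<pi> = return_pmf []"

definition transcript ::
    "('x, 'y) protocol \<Rightarrow> rand \<Rightarrow> rand \<Rightarrow> rand \<Rightarrow> 'x \<Rightarrow> 'y \<Rightarrow> bool list" where
  "transcript \<pi> r rA rB x y = bits_sent (ptree \<pi> r) rA rB x y"

text \<open>
  The cost is extended-valued because the public coins may select trees of unbounded depth;
  a finite supremum is a maximum.
\<close>

definition cost :: "'x set \<Rightarrow> 'y set \<Rightarrow> ('x, 'y) protocol \<Rightarrow> enat" where
  "cost X Y \<pi> = (SUP (r, rA, rB) \<in> set_pmf (coins \<pi>). SUP (x, y) \<in> X \<times> Y.
     enat (length (transcript \<pi> r rA rB x y)))"

definition alice_model ::
    "'x set \<Rightarrow> 'y set \<Rightarrow> ('x \<Rightarrow> 'y \<Rightarrow> 'z) \<Rightarrow> real \<Rightarrow> ('x, 'y) protocol \<Rightarrow> bool" where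
  "alice_model X Y f \<epsilon> \<pi> \<longleftrightarrow>
     (\<exists>OA :: bool list \<Rightarrow> rand \<Rightarrow> rand \<Rightarrow> 'x \<Rightarrow> 'z. \<forall>x\<in>X. \<forall>y\<in>Y.
        measure_pmf.prob (coins \<pi>)
          {(r, rA, rB). OA (transcript \<pi> r rA rB x y) r rA x = f x y} \<ge> 1 - \<epsilon>)"

definition bob_model ::
    "'x set \<Rightarrow> 'y set \<Rightarrow> ('x \<Rightarrow> 'y \<Rightarrow> 'z) \<Rightarrow> real \<Rightarrow> ('x, 'y) protocol \<Rightarrow> bool" where
  "bob_model X Y f \<epsilon> \<pi> \<longleftrightarrow>
     (\<exists>OB :: bool list \<Rightarrow> rand \<Rightarrow> rand \<Rightarrow> 'y \<Rightarrow> 'z. \<forall>x\<in>X. \<forall>y\<in>Y.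
        measure_pmf.prob (coins \<pi>)
          {(r, rA, rB). OB (transcript \<pi> r rA rB x y) r rB y = f x y} \<ge> 1 - \<epsilon>)"

text \<open>The output \<open>\<top>\<close> is rendered as \<open>None\<close>.\<close>

definition oot_model ::
    "'x set \<Rightarrow> 'y set \<Rightarrow> ('x \<Rightarrow> 'y \<Rightarrow> 'z) \<Rightarrow> real \<Rightarrow> ('x, 'y) protocol \<Rightarrow> bool" where
  "oot_model X Y f \<epsilon> \<pi> \<longleftrightarrow>
     (\<exists>(OA :: bool list \<Rightarrow> rand \<Rightarrow> rand \<Rightarrow> 'x \<Rightarrow> 'z option)
       (OB :: bool list \<Rightarrow> rand \<Rightarrow> rand \<Rightarrow> 'y \<Rightarrow> 'z option). \<forall>x\<in>X. \<forall>y\<in>Y.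
        measure_pmf.prob (coins \<pi>)
          {(r, rA, rB).
             (OA (transcript \<pi> r rA rB x y) r rA x, OB (transcript \<pi> r rA rB x y) r rB y)
               \<in> {(Some (f x y), None), (None, Some (f x y))}} \<ge> 1 - \<epsilon>)"

definition min_cost :: "'x set \<Rightarrow> 'y set \<Rightarrow> (('x, 'y) protocol \<Rightarrow> bool) \<Rightarrow> nat" where
  "min_cost X Y P = (LEAST c. \<exists>\<pi>. P \<pi> \<and> cost X Y \<pi> = enat c)"

definition R_oot :: "'x set \<Rightarrow> 'y set \<Rightarrow> ('x \<Rightarrow> 'y \<Rightarrow> 'z) \<Rightarrow> real \<Rightarrow> nat" where
  "R_oot X Y f \<epsilon> = min_cost X Y (oot_model X Y f \<epsilon>)"

definition R_A :: "'x set \<Rightarrow> 'y set \<Rightarrow> ('x \<Rightarrow> 'y \<Rightarrow> 'z) \<Rightarrow> real \<Rightarrow> nat" where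
  "R_A X Y f \<epsilon> = min_cost X Y (alice_model X Y f \<epsilon>)"

definition R_B :: "'x set \<Rightarrow> 'y set \<Rightarrow> ('x \<Rightarrow> 'y \<Rightarrow> 'z) \<Rightarrow> real \<Rightarrow> nat" where
  "R_B X Y f \<epsilon> = min_cost X Y (bob_model X Y f \<epsilon>)"

definition R_uni :: "'x set \<Rightarrow> 'y set \<Rightarrow> ('x \<Rightarrow> 'y \<Rightarrow> 'z) \<Rightarrow> real \<Rightarrow> nat" where
  "R_uni X Y f \<epsilon> = min (R_A X Y f \<epsilon>) (R_B X Y f \<epsilon>)"

definition R_oot_priv :: "'x set \<Rightarrow> 'y set \<Rightarrow> ('x \<Rightarrow> 'y \<Rightarrow> 'z) \<Rightarrow> real \<Rightarrow> nat" where
  "R_oot_priv X Y f \<epsilon> = min_cost X Y (\<lambda>\<pi>. private_coin \<pi> \<and> oot_model X Y f \<epsilon> \<pi>)"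

definition R_A_priv :: "'x set \<Rightarrow> 'y set \<Rightarrow> ('x \<Rightarrow> 'y \<Rightarrow> 'z) \<Rightarrow> real \<Rightarrow> nat" where
  "R_A_priv X Y f \<epsilon> = min_cost X Y (\<lambda>\<pi>. private_coin \<pi> \<and> alice_model X Y f \<epsilon> \<pi>)"

definition R_B_priv :: "'x set \<Rightarrow> 'y set \<Rightarrow> ('x \<Rightarrow> 'y \<Rightarrow> 'z) \<Rightarrow> real \<Rightarrow> nat" where
  "R_B_priv X Y f \<epsilon> = min_cost X Y (\<lambda>\<pi>. private_coin \<pi> \<and> bob_model X Y f \<epsilon> \<pi>)"

definition R_uni_priv :: "'x set \<Rightarrow> 'y set \<Rightarrow> ('x \<Rightarrow> 'y \<Rightarrow> 'z) \<Rightarrow> real \<Rightarrow> nat" where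
  "R_uni_priv X Y f \<epsilon> = min (R_A_priv X Y f \<epsilon>) (R_B_priv X Y f \<epsilon>)"

definition bitstrings :: "nat \<Rightarrow> bool list set" where
  "bitstrings n = {x. length x = n}"

text \<open>The head of the list is the most significant bit.\<close>

definition bin_val :: "bool list \<Rightarrow> nat" where
  "bin_val x = horner_sum of_bool 2 (rev x)"

text \<open>\<open>bin_MAX\<close> restricted to \<open>bitstrings n\<close> in both arguments is \<open>MAX\<^sub>n\<close>.\<close>

definition bin_MAX :: "bool list \<Rightarrow> bool list \<Rightarrow> bool list" where
  "bin_MAX x y = (if bin_val x \<ge> bin_val y then x else y)"

end

(* Lower bound: on inputs (0, y) Alice has to output y, so for some fixed coins the transcript
   determines y for more than half of all y, and there are at most 2^(c+1) transcripts of length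
   at most c. The Bob model is symmetric.

   Upper bound: it suffices that both players learn the single bit x >= y: then whoever holds the
   maximum outputs it. The bit is found by a noisy binary search for the length of the longest
   common prefix, comparing prefixes by hash values of constant length and backtracking when a
   comparison fails. Every honest answer brings the search one step closer to its goal, every hash
   collision moves it at most one step away, so 3m steps with at most m collisions find the position
   among 2^m. Collisions are bounded by linearity of expectation and Markov's inequality. By Newman's
   argument, 2^m > n fixed choices of the hash functions suffice for all inputs, so Alice can
   announce hers with m private bits. *)

theory Submission
  imports Defs
begin

section \<open>Bit strings\<close>

lemma bitstrings_alt: "bitstrings n = {xs. set xs \<subseteq> UNIV \<and> length xs = n}"
  by (simp add: bitstrings_def)

lemma finite_bitstrings: "finite (bitstrings n)"
  unfolding bitstrings_alt by (rule finite_lists_length_eq) simp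

lemma card_bitstrings: "card (bitstrings n) = 2 ^ n"
  unfolding bitstrings_alt by (subst card_lists_length_eq) auto

lemma bitstrings_nonempty: "bitstrings n \<noteq> {}"
  using card_bitstrings[of n] by auto

lemma bin_val_Cons: "bin_val (b # xs) = of_bool b * 2 ^ length xs + bin_val xs"
  by (simp add: bin_val_def horner_sum_append)

lemma bin_val_less: "bin_val xs < 2 ^ length xs"
  using horner_sum_bound[of "rev xs", where ?'a = nat] by (simp add: bin_val_def)

text \<open>All bits after the first difference together weigh less than the differing bit, by
  \<open>bin_val_less\<close>.\<close>

lemma bin_val_le_iff_first_difference:
  assumes "length x = length y" "take d x = take d y" "d < length x" "x ! d \<noteq> y ! d"
  shows "bin_val y \<le> bin_val x \<longleftrightarrow> x ! d"
  using assms
proof (induction x y arbitrary: d rule: list_induct2)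
  case (Cons a x b y)
  then show ?case
    using bin_val_less[of x] bin_val_less[of y]
    by (cases d) (auto simp: bin_val_Cons)
qed simp

text \<open>Equality of prefixes is monotone in their length, with threshold \<open>d\<close>. This
  monotone predicate is what the binary search works on.\<close>

lemma first_difference:
  fixes x y :: "bool list"
  assumes "length x = length y" "x \<noteq> y"
  obtains d where "d < length x" "x ! d \<noteq> y ! d" "\<And>i. take i x = take i y \<longleftrightarrow> i \<le> d"
proof -
  define d where "d = (LEAST i. i < length x \<and> x ! i \<noteq> y ! i)"
  have "\<exists>i. i < length x \<and> x ! i \<noteq> y ! i"
    using assms nth_equalityI by blast
  then have d: "d < length x \<and> x ! d \<noteq> y ! d"
    unfolding d_def by (rule LeastI_ex)
  have min: "x ! i = y ! i" if "i < d" for i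
    using not_less_Least[OF that[unfolded d_def]] that d by auto
  have "take i x = take i y \<longleftrightarrow> i \<le> d" for i
  proof
    assume "take i x = take i y"
    then show "i \<le> d"
      using d nth_take[of d i x] nth_take[of d i y] by (cases "d < i") auto
  next
    assume "i \<le> d"
    then show "take i x = take i y"
      using assms d min by (intro nth_equalityI) auto
  qed
  with d show ?thesis using that by blast
qed

section \<open>Linear lower bound in the one-sided models\<close>

lemma card_le_of_inj_short_lists:
  fixes g :: "'a \<Rightarrow> bool list"
  assumes "inj_on g S" "\<And>s. s \<in> S \<Longrightarrow> length (g s) \<le> c"
  shows "card S \<le> 2 ^ (c + 1)"
proof -
  have "card S \<le> card {xs :: bool list. set xs \<subseteq> UNIV \<and> length xs \<le> c}"
    using assms by (intro card_inj_on_le[of g]) (auto intro: finite_lists_length_le[of UNIV, simplified])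
  also have "\<dots> = (\<Sum>i\<le>c. 2 ^ i)"
    by (subst card_lists_length_le) auto
  also have "\<dots> \<le> 2 ^ (c + 1)"
    by (induction c) auto
  finally show ?thesis .
qed

lemma transcript_length_le_cost:
  assumes "cost X Y \<pi> = enat c" "(r, rA, rB) \<in> set_pmf (coins \<pi>)" "x \<in> X" "y \<in> Y"
  shows "length (transcript \<pi> r rA rB x y) \<le> c"
proof -
  have "enat (length (transcript \<pi> r rA rB x y)) \<le> cost X Y \<pi>"
    unfolding cost_def using assms
    by (auto intro!: SUP_upper2[of "(r, rA, rB)"] SUP_upper2[of "(x, y)"])
  then show ?thesis using assms by simp
qed

text \<open>Double counting: the success probabilities sum to the expected number of inputs on which
  the coins succeed, and that number never exceeds \<open>b\<close>.\<close>

lemma measure_pmf_average_le: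
  fixes p :: "'a pmf" and I :: "'i set"
  assumes fin: "finite I"
    and prob: "\<And>i. i \<in> I \<Longrightarrow> measure_pmf.prob p (E i) \<ge> q"
    and bound: "\<And>\<omega>. \<omega> \<in> set_pmf p \<Longrightarrow> real (card {i \<in> I. \<omega> \<in> E i}) \<le> b"
  shows "q * real (card I) \<le> b"
proof -
  have "q * real (card I) = (\<Sum>i\<in>I. q)" by simp
  also have "\<dots> \<le> (\<Sum>i\<in>I. measure_pmf.prob p (E i))"
    using prob by (rule sum_mono)
  also have "\<dots> = (\<Sum>i\<in>I. measure_pmf.expectation p (indicator (E i)))"
    by simp
  also have "\<dots> = measure_pmf.expectation p (\<lambda>\<omega>. \<Sum>i\<in>I. indicator (E i) \<omega>)"
    by (rule Bochner_Integration.integral_sum[symmetric])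
       (auto intro!: measure_pmf.integrable_const_bound[where B = 1])
  also have "(\<lambda>\<omega>. \<Sum>i\<in>I. indicator (E i) \<omega>) = (\<lambda>\<omega>. real (card {i \<in> I. \<omega> \<in> E i}))"
    using fin by (intro ext) (simp add: indicator_def sum.If_cases Int_def)
  also have "measure_pmf.expectation p (\<lambda>\<omega>. real (card {i \<in> I. \<omega> \<in> E i})) \<le> b"
  proof (rule measure_pmf.integral_le_const)
    show "integrable (measure_pmf p) (\<lambda>\<omega>. real (card {i \<in> I. \<omega> \<in> E i}))"
      using fin by (intro measure_pmf.integrable_const_bound[where B = "card I"])
        (auto intro!: AE_I2 card_mono)
    show "AE \<omega> in measure_pmf p. real (card {i \<in> I. \<omega> \<in> E i}) \<le> b"
      using bound by (simp add: AE_measure_pmf_iff)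
  qed
  finally show ?thesis .
qed

lemma bin_val_zeros: "bin_val (replicate n False) = 0"
  by (induction n) (auto simp: bin_val_Cons, simp add: bin_val_def)

lemma bin_val_eq_0: "bin_val x = 0 \<Longrightarrow> x = replicate (length x) False"
  by (induction x) (auto simp: bin_val_Cons of_bool_def split: if_splits)

lemma bin_MAX_zeros_left: "y \<in> bitstrings n \<Longrightarrow> bin_MAX (replicate n False) y = y"
  using bin_val_eq_0[of y] by (auto simp: bin_MAX_def bin_val_zeros bitstrings_def)

lemma bin_MAX_zeros_right: "bin_MAX x (replicate n False) = x"
  by (simp add: bin_MAX_def bin_val_zeros)

lemma length_bound_from_average:
  fixes \<epsilon> :: real
  assumes "\<epsilon> < 1 / 2" "(1 - \<epsilon>) * 2 ^ n \<le> 2 ^ (c + 1)"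
  shows "n \<le> c + 2"
proof -
  have "(2::real) ^ n < 2 ^ (c + 2)"
  proof -
    have "2 ^ n / 2 < (1 - \<epsilon>) * 2 ^ n"
      using mult_strict_right_mono[of "1 / 2" "1 - \<epsilon>" "2 ^ n"] assms(1) by simp
    also note assms(2)
    finally show ?thesis by simp
  qed
  then have "n < c + 2" by (rule power_less_imp_less_exp[rotated]) simp
  then show ?thesis by simp
qed

lemma alice_model_cost_lower:
  assumes "\<epsilon> < 1 / 2" "alice_model (bitstrings n) (bitstrings n) bin_MAX \<epsilon> \<pi>"
    "cost (bitstrings n) (bitstrings n) \<pi> = enat c"
  shows "n \<le> c + 2"
proof -
  let ?z = "replicate n False"
  have z: "?z \<in> bitstrings n" by (simp add: bitstrings_def)
  obtain OA where OA: "\<And>x y. x \<in> bitstrings n \<Longrightarrow> y \<in> bitstrings n \<Longrightarrow>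
      measure_pmf.prob (coins \<pi>)
          {(r, rA, rB). OA (transcript \<pi> r rA rB x y) r rA x = bin_MAX x y} \<ge> 1 - \<epsilon>"
    using assms(2) unfolding alice_model_def by blast
  have "(1 - \<epsilon>) * real (card (bitstrings n)) \<le> 2 ^ (c + 1)"
  proof (rule measure_pmf_average_le[OF finite_bitstrings OA[OF z]])
    fix \<omega> assume \<omega>: "\<omega> \<in> set_pmf (coins \<pi>)"
    obtain r rA rB where [simp]: "\<omega> = (r, rA, rB)" by (cases \<omega>)
    let ?S = "{y \<in> bitstrings n.
      \<omega> \<in> {(r, rA, rB). OA (transcript \<pi> r rA rB ?z y) r rA ?z = bin_MAX ?z y}}"
    \<comment> \<open>With the coins and Alice's input fixed, her output map decodes
      \<open>y\<close> from the transcript.\<close>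
    have "inj_on (transcript \<pi> r rA rB ?z) ?S"
      by (rule inj_on_inverseI[where g = "\<lambda>t. OA t r rA ?z"]) (auto simp: bin_MAX_zeros_left)
    then have "card ?S \<le> 2 ^ (c + 1)"
      by (rule card_le_of_inj_short_lists)
        (use \<omega> z in \<open>auto intro: transcript_length_le_cost[OF assms(3)]\<close>)
    then show "real (card ?S) \<le> 2 ^ (c + 1)"
      using of_nat_le_iff[of "card ?S" "2 ^ (c + 1)", where ?'a = real] by simp
  qed
  then show ?thesis
    using assms(1) by (intro length_bound_from_average) (simp_all add: card_bitstrings)
qed

lemma bob_model_cost_lower:
  assumes "\<epsilon> < 1 / 2" "bob_model (bitstrings n) (bitstrings n) bin_MAX \<epsilon> \<pi>"
    "cost (bitstrings n) (bitstrings n) \<pi> = enat c"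
  shows "n \<le> c + 2"
proof -
  let ?z = "replicate n False"
  have z: "?z \<in> bitstrings n" by (simp add: bitstrings_def)
  obtain OB where OB: "\<And>x y. x \<in> bitstrings n \<Longrightarrow> y \<in> bitstrings n \<Longrightarrow>
      measure_pmf.prob (coins \<pi>)
          {(r, rA, rB). OB (transcript \<pi> r rA rB x y) r rB y = bin_MAX x y} \<ge> 1 - \<epsilon>"
    using assms(2) unfolding bob_model_def by blast
  have "(1 - \<epsilon>) * real (card (bitstrings n)) \<le> 2 ^ (c + 1)"
  proof (rule measure_pmf_average_le[OF finite_bitstrings OB[OF _ z]])
    fix \<omega> assume \<omega>: "\<omega> \<in> set_pmf (coins \<pi>)"
    obtain r rA rB where [simp]: "\<omega> = (r, rA, rB)" by (cases \<omega>)
    let ?S = "{x \<in> bitstrings n.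
      \<omega> \<in> {(r, rA, rB). OB (transcript \<pi> r rA rB x ?z) r rB ?z = bin_MAX x ?z}}"
    have "inj_on (\<lambda>x. transcript \<pi> r rA rB x ?z) ?S"
      by (rule inj_on_inverseI[where g = "\<lambda>t. OB t r rB ?z"]) (auto simp: bin_MAX_zeros_right)
    then have "card ?S \<le> 2 ^ (c + 1)"
      by (rule card_le_of_inj_short_lists)
        (use \<omega> z in \<open>auto intro: transcript_length_le_cost[OF assms(3)]\<close>)
    then show "real (card ?S) \<le> 2 ^ (c + 1)"
      using of_nat_le_iff[of "card ?S" "2 ^ (c + 1)", where ?'a = real] by simp
  qed
  then show ?thesis
    using assms(1) by (intro length_bound_from_average) (simp_all add: card_bitstrings)
qed

section \<open>Building protocols\<close>

text \<open>Continuation style: the rest of the tree is indexed by the block just sent, so later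
  messages may depend on it.\<close>

primrec alice_sends ::
    "nat \<Rightarrow> (rand \<Rightarrow> 'x \<Rightarrow> bool list) \<Rightarrow> (bool list \<Rightarrow> ('x, 'y) ptree) \<Rightarrow> ('x, 'y) ptree" where
  "alice_sends 0 f t = t []"
| "alice_sends (Suc k) f t = Alice (\<lambda>r x. hd (f r x))
     (alice_sends k (\<lambda>r x. tl (f r x)) (\<lambda>bs. t (False # bs)))
     (alice_sends k (\<lambda>r x. tl (f r x)) (\<lambda>bs. t (True # bs)))"

primrec bob_sends ::
    "nat \<Rightarrow> (rand \<Rightarrow> 'y \<Rightarrow> bool list) \<Rightarrow> (bool list \<Rightarrow> ('x, 'y) ptree) \<Rightarrow> ('x, 'y) ptree" where
  "bob_sends 0 f t = t []"
| "bob_sends (Suc k) f t = Bob (\<lambda>r y. hd (f r y))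
     (bob_sends k (\<lambda>r y. tl (f r y)) (\<lambda>bs. t (False # bs)))
     (bob_sends k (\<lambda>r y. tl (f r y)) (\<lambda>bs. t (True # bs)))"

lemma bits_sent_alice_sends:
  "length (f rA x) = k \<Longrightarrow>
     bits_sent (alice_sends k f t) rA rB x y = f rA x @ bits_sent (t (f rA x)) rA rB x y"
proof (induction k arbitrary: f t)
  case (Suc k)
  then obtain b bs where "f rA x = b # bs" "length bs = k" by (auto simp: length_Suc_conv)
  then show ?case using Suc.IH[of "\<lambda>r x. tl (f r x)"] by auto
qed simp

lemma bits_sent_bob_sends:
  "length (f rB y) = k \<Longrightarrow>
     bits_sent (bob_sends k f t) rA rB x y = f rB y @ bits_sent (t (f rB y)) rA rB x y"
proof (induction k arbitrary: f t)
  case (Suc k)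
  then obtain b bs where "f rB y = b # bs" "length bs = k" by (auto simp: length_Suc_conv)
  then show ?case using Suc.IH[of "\<lambda>r y. tl (f r y)"] by auto
qed simp

lemma cost_const:
  assumes "X \<noteq> {}" "Y \<noteq> {}"
    "\<And>r rA rB x y. (r, rA, rB) \<in> set_pmf (coins \<pi>) \<Longrightarrow> x \<in> X \<Longrightarrow> y \<in> Y \<Longrightarrow>
       length (transcript \<pi> r rA rB x y) = c"
  shows "cost X Y \<pi> = enat c"
proof -
  have "(SUP (x, y) \<in> X \<times> Y. enat (length (transcript \<pi> r rA rB x y))) = enat c"
    if "(r, rA, rB) \<in> set_pmf (coins \<pi>)" for r rA rB
    using assms that by (intro antisym SUP_least) (auto intro: SUP_upper2)
  then have "cost X Y \<pi> = (SUP \<omega> \<in> set_pmf (coins \<pi>). enat c)"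
    unfolding cost_def by (intro SUP_cong) auto
  then show ?thesis by (simp add: set_pmf_not_empty)
qed

text \<open>Only Alice tosses coins: she announces the seed, and Bob answers
  deterministically.\<close>

definition private_protocol :: "rand pmf \<Rightarrow> ('x, 'y) ptree \<Rightarrow> ('x, 'y) protocol" where
  "private_protocol p t = \<lparr>pub = return_pmf [], privA = p, privB = return_pmf [], ptree = \<lambda>_. t\<rparr>"

lemma private_coin_private_protocol: "private_coin (private_protocol p t)"
  by (simp add: private_coin_def private_protocol_def)

lemma transcript_private_protocol:
  "transcript (private_protocol p t) r rA rB x y = bits_sent t rA rB x y"
  by (simp add: transcript_def private_protocol_def)

lemma coins_private_protocol:
  "coins (private_protocol p t) = map_pmf (\<lambda>rA. ([], rA, [])) p"
  by (simp add: coins_def private_protocol_def pair_return_pmf1 pair_return_pmf2 map_pmf_comp)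

section \<open>Bounds on minimum costs\<close>

lemma min_cost_le: "P \<pi> \<Longrightarrow> cost X Y \<pi> = enat c \<Longrightarrow> min_cost X Y P \<le> c"
  unfolding min_cost_def by (rule Least_le) auto

text \<open>\<open>LEAST\<close> over an empty set is unspecified, so a lower bound also calls for
  one admissible protocol of finite cost.\<close>

lemma min_cost_ge:
  assumes "P \<pi>" "cost X Y \<pi> = enat c" "\<And>\<pi> c. P \<pi> \<Longrightarrow> cost X Y \<pi> = enat c \<Longrightarrow> b \<le> c"
  shows "b \<le> min_cost X Y P"
proof -
  have "\<exists>c \<pi>. P \<pi> \<and> cost X Y \<pi> = enat c" using assms by blast
  then have "\<exists>\<pi>. P \<pi> \<and> cost X Y \<pi> = enat (min_cost X Y P)"
    unfolding min_cost_def by (rule LeastI_ex)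
  then show ?thesis using assms by blast
qed

text \<open>Supplies the witness for \<open>min_cost_ge\<close>: Bob sends his whole input.\<close>

lemma alice_model_trivial:
  fixes n :: nat
  assumes "0 \<le> \<epsilon>"
  obtains \<pi> :: "(bool list, bool list) protocol" where "private_coin \<pi>"
    "alice_model (bitstrings n) (bitstrings n) f \<epsilon> \<pi>"
    "cost (bitstrings n) (bitstrings n) \<pi> = enat n"
proof -
  let ?\<pi> = "private_protocol (return_pmf []) (bob_sends n (\<lambda>_ y. y) (\<lambda>_. Halt))
    :: (bool list, bool list) protocol"
  have tr: "transcript ?\<pi> r rA rB x y = y" if "y \<in> bitstrings n" for r rA rB x y
    using that by (simp add: transcript_private_protocol bits_sent_bob_sends bitstrings_def)
  have "alice_model (bitstrings n) (bitstrings n) f \<epsilon> ?\<pi>"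
    unfolding alice_model_def using assms
    by (intro exI[of _ "\<lambda>t _ _ x. f x t"]) (simp add: tr case_prod_unfold)
  moreover have "cost (bitstrings n) (bitstrings n) ?\<pi> = enat n"
    using bitstrings_nonempty by (intro cost_const) (simp_all add: tr, simp add: bitstrings_def)
  ultimately show ?thesis using that private_coin_private_protocol by blast
qed

lemma bob_model_trivial:
  fixes n :: nat
  assumes "0 \<le> \<epsilon>"
  obtains \<pi> :: "(bool list, bool list) protocol" where "private_coin \<pi>"
    "bob_model (bitstrings n) (bitstrings n) f \<epsilon> \<pi>"
    "cost (bitstrings n) (bitstrings n) \<pi> = enat n"
proof -
  let ?\<pi> = "private_protocol (return_pmf []) (alice_sends n (\<lambda>_ x. x) (\<lambda>_. Halt))
    :: (bool list, bool list) protocol"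
  have tr: "transcript ?\<pi> r rA rB x y = x" if "x \<in> bitstrings n" for r rA rB x y
    using that by (simp add: transcript_private_protocol bits_sent_alice_sends bitstrings_def)
  have "bob_model (bitstrings n) (bitstrings n) f \<epsilon> ?\<pi>"
    unfolding bob_model_def using assms
    by (intro exI[of _ "\<lambda>t _ _ y. f t y"]) (simp add: tr case_prod_unfold)
  moreover have "cost (bitstrings n) (bitstrings n) ?\<pi> = enat n"
    using bitstrings_nonempty by (intro cost_const) (simp_all add: tr, simp add: bitstrings_def)
  ultimately show ?thesis using that private_coin_private_protocol by blast
qed

lemma R_uni_bin_MAX_ge:
  assumes "0 < \<epsilon>" "\<epsilon> < 1 / 2"
  shows "n - 2 \<le> R_uni (bitstrings n) (bitstrings n) bin_MAX \<epsilon>"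
    and "n - 2 \<le> R_uni_priv (bitstrings n) (bitstrings n) bin_MAX \<epsilon>"
proof -
  obtain \<pi>A :: "(bool list, bool list) protocol" where A: "private_coin \<pi>A"
    "alice_model (bitstrings n) (bitstrings n) bin_MAX \<epsilon> \<pi>A"
    "cost (bitstrings n) (bitstrings n) \<pi>A = enat n"
    using alice_model_trivial[of \<epsilon> n bin_MAX] assms by auto
  obtain \<pi>B :: "(bool list, bool list) protocol" where B: "private_coin \<pi>B"
    "bob_model (bitstrings n) (bitstrings n) bin_MAX \<epsilon> \<pi>B"
    "cost (bitstrings n) (bitstrings n) \<pi>B = enat n"
    using bob_model_trivial[of \<epsilon> n bin_MAX] assms by auto
  note lower = alice_model_cost_lower[OF assms(2)] bob_model_cost_lower[OF assms(2)]
  have "n - 2 \<le> R_A (bitstrings n) (bitstrings n) bin_MAX \<epsilon>"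
    unfolding R_A_def by (rule min_cost_ge[of "alice_model _ _ _ _", OF A(2,3)]) (drule (1) lower, simp)
  moreover have "n - 2 \<le> R_B (bitstrings n) (bitstrings n) bin_MAX \<epsilon>"
    unfolding R_B_def by (rule min_cost_ge[of "bob_model _ _ _ _", OF B(2,3)]) (drule (1) lower, simp)
  ultimately show "n - 2 \<le> R_uni (bitstrings n) (bitstrings n) bin_MAX \<epsilon>"
    by (simp add: R_uni_def)
  have "n - 2 \<le> R_A_priv (bitstrings n) (bitstrings n) bin_MAX \<epsilon>"
    unfolding R_A_priv_def
    by (rule min_cost_ge[of "\<lambda>\<pi>. private_coin \<pi> \<and> alice_model _ _ _ _ \<pi>",
          OF conjI[OF A(1,2)] A(3)]) (drule (1) lower[OF conjunct2], simp)
  moreover have "n - 2 \<le> R_B_priv (bitstrings n) (bitstrings n) bin_MAX \<epsilon>"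
    unfolding R_B_priv_def
    by (rule min_cost_ge[of "\<lambda>\<pi>. private_coin \<pi> \<and> bob_model _ _ _ _ \<pi>",
          OF conjI[OF B(1,2)] B(3)]) (drule (1) lower[OF conjunct2], simp)
  ultimately show "n - 2 \<le> R_uni_priv (bitstrings n) (bitstrings n) bin_MAX \<epsilon>"
    by (simp add: R_uni_priv_def)
qed

section \<open>Binary search with unreliable answers\<close>

text \<open>A path in the binary tree of dyadic subintervals of \<open>[0, 2 ^ m)\<close>, last step first; steps
  below a leaf leave the interval unchanged.\<close>

primrec lo :: "nat \<Rightarrow> bool list \<Rightarrow> nat" where
  "lo m [] = 0"
| "lo m (c # w) = lo m w + (if c \<and> length w < m then 2 ^ (m - Suc (length w)) else 0)"

text \<open>The upper end is exclusive. Truncated subtraction keeps the interval at length 1 on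
  paths longer than \<open>m\<close>.\<close>

definition hi :: "nat \<Rightarrow> bool list \<Rightarrow> nat" where
  "hi m w = lo m w + 2 ^ (m - length w)"

lemma hi_Nil: "hi m [] = 2 ^ m"
  by (simp add: hi_def)

text \<open>Above the leaves, \<open>lo m (True # w)\<close> is the midpoint: the left half ends
  where the right half begins.\<close>

lemma hi_Cons:
  "hi m (c # w) = (if c \<or> m \<le> length w then hi m w else lo m (True # w))"
proof (cases "length w < m")
  case True
  then have "(2::nat) ^ (m - length w) = 2 * 2 ^ (m - Suc (length w))"
    by (simp add: Suc_diff_Suc flip: power_Suc)
  then show ?thesis using True by (simp add: hi_def)
qed (simp add: hi_def)

lemma hi_Cons_le: "hi m (c # w) \<le> hi m w"
  using hi_Cons[of m True w] by (auto simp: hi_Cons) (simp add: hi_def)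

lemma lo_less_hi: "lo m w < hi m w"
  by (simp add: hi_def)

lemma hi_le: "hi m w \<le> 2 ^ m"
  by (induction w) (auto simp: hi_Nil intro: order_trans[OF hi_Cons_le])

definition on_path :: "nat \<Rightarrow> nat \<Rightarrow> bool list \<Rightarrow> bool" where
  "on_path m d w \<longleftrightarrow> lo m w \<le> d \<and> d < hi m w"

lemma on_path_leaf: "m \<le> length w \<Longrightarrow> on_path m d (c # w) \<longleftrightarrow> on_path m d w"
  by (simp add: on_path_def hi_Cons)

text \<open>A potential function. Intervals along a path are nested, so the on-path steps come
  first; each later step counts against them because it must be undone.\<close>

primrec progress :: "nat \<Rightarrow> nat \<Rightarrow> bool list \<Rightarrow> int" where
  "progress m d [] = 0"
| "progress m d (c # w) = progress m d w + (if on_path m d (c # w) then 1 else - 1)"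

lemma progress_le_length: "progress m d w \<le> int (length w)"
  by (induction w) auto

text \<open>If the newest step were off the path, the steps before it would have even more progress
  and by induction already sit at the leaf of \<open>d\<close>. Steps below a leaf keep its
  interval, so the newest one could not have left it.\<close>

lemma lo_eq_of_progress:
  assumes "d < 2 ^ m" "int m \<le> progress m d w"
  shows "m \<le> length w \<and> lo m w = d"
  using assms
proof (induction w)
  case Nil
  then show ?case by simp
next
  case (Cons c w)
  have len: "m \<le> length (c # w)"
    using Cons.prems progress_le_length[of m d "c # w"] by linarith
  have "on_path m d (c # w)"
  proof (rule ccontr)
    assume off: "\<not> on_path m d (c # w)"
    then have "m \<le> length w \<and> lo m w = d"
      using Cons by simp
    then have "m \<le> length w" "on_path m d w"
      by (auto simp: on_path_def lo_less_hi)
    then show False using off by (simp add: on_path_leaf)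
  qed
  with len show ?case
    by (simp add: on_path_def hi_def del: lo.simps)
qed

type_synonym hash = "bool list \<Rightarrow> bool list"

text \<open>Unequal hash values are always right, so only the lower end of the current interval can be
  wrong; it is tested first, and a failed test undoes the last step.\<close>

definition advance :: "nat \<Rightarrow> bool list \<Rightarrow> bool list \<Rightarrow> hash \<Rightarrow> bool list \<Rightarrow> bool list" where
  "advance m x y h w =
     (if h (take (lo m w) x) = h (take (lo m w) y)
      then (h (take (lo m (True # w)) x) = h (take (lo m (True # w)) y)) # w else tl w)"

text \<open>Both positions count, even when \<open>advance\<close> ignores the second test. This
  makes the event a union of two collisions at positions fixed by \<open>w\<close>.\<close>

definition deceived :: "nat \<Rightarrow> bool list \<Rightarrow> bool list \<Rightarrow> hash \<Rightarrow> bool list \<Rightarrow> bool" where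
  "deceived m x y h w \<longleftrightarrow> (\<exists>i \<in> {lo m w, lo m (True # w)}.
     take i x \<noteq> take i y \<and> h (take i x) = h (take i y))"

text \<open>The case \<open>x = y\<close> is covered by \<open>d = 2 ^ m - 1\<close>.\<close>

definition agree_upto :: "nat \<Rightarrow> nat \<Rightarrow> 'a list \<Rightarrow> 'a list \<Rightarrow> bool" where
  "agree_upto m d x y \<longleftrightarrow> d < 2 ^ m \<and> (\<forall>i < 2 ^ m. take i x = take i y \<longleftrightarrow> i \<le> d)"

lemma agree_upto_lo:
  "agree_upto m d x y \<Longrightarrow> take (lo m w) x = take (lo m w) y \<longleftrightarrow> lo m w \<le> d"
  using lo_less_hi[of m w] hi_le[of m w] unfolding agree_upto_def by auto

text \<open>The upper end drops only after a failed test at the midpoint, and unequal hash values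
  prove that the prefixes differ. Undoing a step can only raise it.\<close>

lemma advance_less_hi:
  assumes "agree_upto m d x y" "d < hi m w"
  shows "d < hi m (advance m x y h w)"
proof (cases "h (take (lo m w) x) = h (take (lo m w) y)")
  case False
  then show ?thesis
    using assms hi_Cons_le[of m "hd w" "tl w"] by (cases w) (auto simp: advance_def simp del: lo.simps)
next
  case True
  then show ?thesis
    using assms agree_upto_lo[OF assms(1), of "True # w"]
    by (auto simp: advance_def hi_Cons not_le simp del: lo.simps)
qed

lemma progress_advance_ge: "progress m d w - 1 \<le> progress m d (advance m x y h w)"
  by (cases w) (auto simp: advance_def)

text \<open>If \<open>lo m w\<close> is at most \<open>d\<close>, then \<open>w\<close> is on the
  path and honest tests choose the half containing \<open>d\<close>. Otherwise \<open>w\<close> is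
  off the path, and backtracking removes a summand -1.\<close>

lemma progress_advance:
  assumes "agree_upto m d x y" "d < hi m w" "\<not> deceived m x y h w"
  shows "progress m d (advance m x y h w) = progress m d w + 1"
proof -
  note lo_iff = agree_upto_lo[OF assms(1)]
  have honest: "h (take (lo m v) x) = h (take (lo m v) y) \<longleftrightarrow> lo m v \<le> d"
    if "v = w \<or> v = True # w" for v
    using assms(3) that lo_iff[of v] unfolding deceived_def by (metis insert_iff)
  show ?thesis
  proof (cases "lo m w \<le> d")
    case True
    then have adv: "advance m x y h w = (lo m (True # w) \<le> d) # w"
      unfolding advance_def using honest by (simp del: lo.simps)
    have "on_path m d ((lo m (True # w) \<le> d) # w)"
    \<comment> \<open>Below a leaf the new step repeats the interval but still earns +1, building a
      reserve against later deceptions.\<close>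
    proof (cases "m \<le> length w")
      case True
      then show ?thesis using \<open>lo m w \<le> d\<close> assms(2) by (simp add: on_path_leaf, simp add: on_path_def)
    next
      case False
      then show ?thesis using \<open>lo m w \<le> d\<close> assms(2)
        by (cases "lo m (True # w) \<le> d") (simp_all add: on_path_def hi_Cons)
    qed
    then show ?thesis using adv by simp
  next
    case False
    \<comment> \<open>At the root the lower end is 0, which cannot exceed \<open>d\<close>, so there
      is a step to undo.\<close>
    then obtain c v where w: "w = c # v" by (cases w) auto
    have "advance m x y h w = v"
      unfolding advance_def using honest False w by (simp del: lo.simps)
    moreover have "\<not> on_path m d w" using False by (simp add: on_path_def)
    ultimately show ?thesis using w by simp
  qed
qed

primrec search :: "nat \<Rightarrow> bool list \<Rightarrow> bool list \<Rightarrow> hash list \<Rightarrow> bool list \<Rightarrow> bool list" where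
  "search m x y [] w = w"
| "search m x y (h # hs) w = search m x y hs (advance m x y h w)"

primrec deceptions :: "nat \<Rightarrow> bool list \<Rightarrow> bool list \<Rightarrow> hash list \<Rightarrow> bool list \<Rightarrow> nat" where
  "deceptions m x y [] w = 0"
| "deceptions m x y (h # hs) w =
     of_bool (deceived m x y h w) + deceptions m x y hs (advance m x y h w)"

text \<open>A deceived step loses at most 1 instead of gaining 1, hence the factor 2.\<close>

lemma progress_search:
  assumes "agree_upto m d x y" "d < hi m w"
  shows "progress m d w + int (length hs) - 2 * int (deceptions m x y hs w)
    \<le> progress m d (search m x y hs w)"
  using assms(2)
proof (induction hs arbitrary: w)
  case (Cons h hs)
  from Cons.IH[OF advance_less_hi[OF assms(1) Cons.prems], of h]
  show ?case
    using progress_advance[OF assms(1) Cons.prems, of h] progress_advance_ge[of m d w x y h]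
    by (cases "deceived m x y h w") auto
qed simp

lemma lo_search:
  assumes "agree_upto m d x y" "length hs = 3 * m" "deceptions m x y hs [] \<le> m"
  shows "lo m (search m x y hs []) = d"
proof -
  have d: "d < 2 ^ m" using assms(1) by (simp add: agree_upto_def)
  \<comment> \<open>The budget is 3m - 2m = m.\<close>
  have "int m \<le> progress m d (search m x y hs [])"
    using progress_search[OF assms(1), of "[]" hs] d assms(2,3) by (simp add: hi_Nil)
  then show ?thesis using lo_eq_of_progress[OF d] by blast
qed

section \<open>Random hash functions\<close>

text \<open>Overwriting the value at \<open>u\<close> by an arbitrary \<open>e\<close> is injective
  on pairs of a value and a colliding function: the lost value is still readable at
  \<open>v\<close>.\<close>

lemma hash_collisions:
  fixes u v :: 'a and E :: "'b set"
  assumes "finite D" "finite E" "u \<in> D" "v \<in> D" "u \<noteq> v"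
  shows "card E * card {h \<in> D \<rightarrow>\<^sub>E E. h u = h v} \<le> card (D \<rightarrow>\<^sub>E E)"
proof -
  let ?C = "{h \<in> D \<rightarrow>\<^sub>E E. h u = h v}"
  have "inj_on (\<lambda>(e, h). h(u := e)) (E \<times> ?C)"
  proof (rule inj_onI, clarify)
    fix e h e' h' assume eq: "h(u := e) = h'(u := e')" and "h u = h v" "h' u = h' v"
    from eq have "e = e'" by (metis fun_upd_same)
    from eq have "h v = h' v" using assms(5) by (metis fun_upd_other)
    then have "h u = h' u" using \<open>h u = h v\<close> \<open>h' u = h' v\<close> by simp
    have "h z = h' z" for z
      using fun_cong[OF eq, of z] \<open>h u = h' u\<close> by (cases "z = u") auto
    with \<open>e = e'\<close> show "e = e' \<and> h = h'" by auto
  qed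
  moreover have "(\<lambda>(e, h). h(u := e)) ` (E \<times> ?C) \<subseteq> D \<rightarrow>\<^sub>E E"
    using assms(3) by (auto simp: PiE_def extensional_def)
  ultimately have "card (E \<times> ?C) \<le> card (D \<rightarrow>\<^sub>E E)"
    using assms by (intro card_inj_on_le) (auto intro: finite_PiE)
  then show ?thesis by (simp add: card_cartesian_product)
qed

text \<open>Union bound over the two tested positions, which do not depend on
  \<open>h\<close>.\<close>

lemma card_deceived:
  assumes fin: "finite H"
    and coll: "\<And>u v. length u \<le> n \<Longrightarrow> length v \<le> n \<Longrightarrow> u \<noteq> v \<Longrightarrow>
      K * card {h \<in> H. h u = h v} \<le> card H"
    and len: "length x = n" "length y = n"
  shows "K * card {h \<in> H. deceived m x y h w} \<le> 2 * card H"
proof -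
  let ?C = "\<lambda>i. {h \<in> H. take i x \<noteq> take i y \<and> h (take i x) = h (take i y)}"
  have C: "K * card (?C i) \<le> card H" for i
    using coll[of "take i x" "take i y"] len by (cases "take i x = take i y") auto
  have "{h \<in> H. deceived m x y h w} = ?C (lo m w) \<union> ?C (lo m (True # w))"
    by (auto simp: deceived_def simp del: lo.simps)
  then have "card {h \<in> H. deceived m x y h w} \<le> card (?C (lo m w)) + card (?C (lo m (True # w)))"
    by (simp only: card_Un_le)
  then have "K * card {h \<in> H. deceived m x y h w}
      \<le> K * (card (?C (lo m w)) + card (?C (lo m (True # w))))"
    by (rule mult_le_mono2)
  also have "\<dots> = K * card (?C (lo m w)) + K * card (?C (lo m (True # w)))"
    by (rule distrib_left)
  also have "\<dots> \<le> 2 * card H"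
    using C[of "lo m w"] C[of "lo m (True # w)"] by linarith
  finally show ?thesis .
qed

section \<open>Counting deceptions over lists of hash functions\<close>

definition lists_of :: "'a set \<Rightarrow> nat \<Rightarrow> 'a list set" where
  "lists_of H t = {hs. set hs \<subseteq> H \<and> length hs = t}"

lemma sum_lists_of_Suc:
  "(\<Sum>hs \<in> lists_of H (Suc t). f hs) = (\<Sum>h\<in>H. \<Sum>hs \<in> lists_of H t. f (h # hs))"
proof -
  have "lists_of H (Suc t) = (\<lambda>(h, hs). h # hs) ` (H \<times> lists_of H t)"
    by (auto simp: lists_of_def length_Suc_conv)
  moreover have "inj_on (\<lambda>(h, hs). h # hs) (H \<times> lists_of H t)"
    by (auto simp: inj_on_def)
  ultimately have "(\<Sum>hs \<in> lists_of H (Suc t). f hs)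
      = (\<Sum>p \<in> H \<times> lists_of H t. f (fst p # snd p))"
    by (simp add: sum.reindex case_prod_unfold)
  then show ?thesis by (simp add: sum.cartesian_product case_prod_unfold)
qed

text \<open>Each hash function is independent of the path it is applied to, so expected deceptions add up
  even though the queries are adaptive.\<close>

lemma sum_deceptions:
  assumes "finite H"
    and "\<And>w. K * card {h \<in> H. deceived m x y h w} \<le> 2 * card H"
  shows "K * (\<Sum>hs \<in> lists_of H t. deceptions m x y hs w) \<le> 2 * t * card H ^ t"
proof (induction t arbitrary: w)
  case 0
  have "lists_of H 0 = {[]}" by (auto simp: lists_of_def)
  then show ?case by simp
next
  case (Suc t)
  have card: "card (lists_of H t) = card H ^ t"
    unfolding lists_of_def by (rule card_lists_length_eq[OF assms(1)])
  have dec: "(\<Sum>h\<in>H. of_bool (deceived m x y h w)) = card {h \<in> H. deceived m x y h w}"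
    using assms(1) by (simp add: of_bool_def sum.If_cases Int_def)
  have "K * (\<Sum>hs \<in> lists_of H (Suc t). deceptions m x y hs w)
    = K * card {h \<in> H. deceived m x y h w} * card H ^ t
      + (\<Sum>h\<in>H. K * (\<Sum>hs \<in> lists_of H t. deceptions m x y hs (advance m x y h w)))"
    unfolding sum_lists_of_Suc deceptions.simps sum.distrib sum_constant card
      sum_distrib_left[symmetric] dec
    by (simp add: distrib_left mult_ac)
  also have "\<dots> \<le> 2 * card H * card H ^ t + (\<Sum>h\<in>H. 2 * t * card H ^ t)"
    by (intro add_mono mult_right_mono sum_mono Suc.IH assms(2)) auto
  also have "\<dots> = 2 * Suc t * card H ^ Suc t"
    by (simp add: algebra_simps)
  finally show ?case .
qed

text \<open>Markov's inequality: the mean number of deceptions in \<open>3 * m\<close> steps is at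
  most 6m/K, so it exceeds \<open>m\<close> on at most a fraction 6/K of the lists.\<close>

lemma card_many_deceptions:
  assumes "finite H" "m > 0"
    and "\<And>w. K * card {h \<in> H. deceived m x y h w} \<le> 2 * card H"
  shows "K * card {hs \<in> lists_of H (3 * m). m < deceptions m x y hs []}
    \<le> 6 * card (lists_of H (3 * m))"
proof -
  let ?L = "lists_of H (3 * m)" and ?B = "{hs \<in> lists_of H (3 * m). m < deceptions m x y hs []}"
  have fin: "finite ?L" and card: "card ?L = card H ^ (3 * m)"
    unfolding lists_of_def using assms(1) by (auto intro: finite_lists_length_eq card_lists_length_eq)
  have "m * card ?B = (\<Sum>hs\<in>?B. m)" by simp
  also have "\<dots> \<le> (\<Sum>hs\<in>?B. deceptions m x y hs [])" by (intro sum_mono) auto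
  also have "\<dots> \<le> (\<Sum>hs\<in>?L. deceptions m x y hs [])" using fin by (intro sum_mono2) auto
  finally have "K * (m * card ?B) \<le> K * (\<Sum>hs\<in>?L. deceptions m x y hs [])" by simp
  also have "\<dots> \<le> 2 * (3 * m) * card ?L"
    unfolding card by (rule sum_deceptions[OF assms(1,3)])
  finally have "m * (K * card ?B) \<le> m * (6 * card ?L)" by (simp add: mult_ac)
  then show ?thesis using assms(2) by simp
qed

section \<open>Few seeds suffice\<close>

text \<open>Newman's argument, with an exponential moment in place of a Chernoff bound: the
  bad events are rare enough for the weight \<open>C\<close> to at most double the total mass per seed.\<close>

lemma seeds_exist:
  fixes B :: "'i \<Rightarrow> 'w set" and S :: "'s set" and C \<epsilon> :: real
  assumes fin: "finite \<Omega>" "\<Omega> \<noteq> {}" "finite S" "finite I"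
    and sub: "\<And>i. i \<in> I \<Longrightarrow> B i \<subseteq> \<Omega>"
    and rare: "\<And>i. i \<in> I \<Longrightarrow> C * real (card (B i)) \<le> real (card \<Omega>)"
    and C: "1 \<le> C" "8 \<le> C powr \<epsilon>"
    and I: "card I \<le> 4 ^ n" "n < card S"
  shows "\<exists>g \<in> S \<rightarrow> \<Omega>. \<forall>i\<in>I. real (card {s \<in> S. g s \<in> B i}) \<le> \<epsilon> * real (card S)"
proof -
  define G where "G = S \<rightarrow>\<^sub>E \<Omega>"
  define N where "N i g = card {s \<in> S. g s \<in> B i}" for i g
  have finG: "finite G" and cardG: "real (card G) = real (card \<Omega>) ^ card S"
    using fin by (auto simp: G_def finite_PiE card_PiE)
  \<comment> \<open>Seeds are chosen independently, so the sum over \<open>g\<close> factors into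
    one copy per seed of the weighted mass of \<open>\<Omega>\<close>, which \<open>rare\<close>
    bounds by twice its size.\<close>
  have moment: "(\<Sum>g\<in>G. C ^ N i g) \<le> (2 * real (card \<Omega>)) ^ card S" if i: "i \<in> I" for i
  proof -
    have "(\<Sum>g\<in>G. C ^ N i g) = (\<Sum>g\<in>G. \<Prod>s\<in>S. if g s \<in> B i then C else 1)"
      using fin by (simp add: N_def prod.If_cases Int_def)
    also have "\<dots> = (\<Prod>s\<in>S. \<Sum>\<omega>\<in>\<Omega>. if \<omega> \<in> B i then C else 1)"
      unfolding G_def using fin by (intro prod_sum_PiE[symmetric]) auto
    also have "\<dots> = (\<Sum>\<omega>\<in>\<Omega>. if \<omega> \<in> B i then C else 1) ^ card S"
      by simp
    also have "\<dots> \<le> (2 * real (card \<Omega>)) ^ card S"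
    proof (rule power_mono)
      have "(\<Sum>\<omega>\<in>\<Omega>. if \<omega> \<in> B i then C else 1) = C * real (card (B i)) + real (card (\<Omega> - B i))"
        using fin sub[OF i] by (simp add: sum.If_cases Int_absorb1 Diff_eq Int_commute)
      also have "\<dots> \<le> real (card \<Omega>) + real (card \<Omega>)"
        using fin by (intro add_mono rare[OF i] of_nat_mono card_mono) auto
      finally show "(\<Sum>\<omega>\<in>\<Omega>. if \<omega> \<in> B i then C else 1) \<le> 2 * real (card \<Omega>)" by simp
      show "0 \<le> (\<Sum>\<omega>\<in>\<Omega>. if \<omega> \<in> B i then C else 1)"
        using C by (intro sum_nonneg) auto
    qed
    finally show ?thesis .
  qed
  have "\<exists>g\<in>G. \<forall>i\<in>I. real (N i g) \<le> \<epsilon> * real (card S)"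
  proof (rule ccontr)
    assume "\<not> ?thesis"
    then have bad: "\<exists>i\<in>I. \<epsilon> * real (card S) < real (N i g)" if "g \<in> G" for g
      using that by (auto simp: not_le)
    have "8 ^ card S \<le> (\<Sum>i\<in>I. C ^ N i g)" if "g \<in> G" for g
    proof -
      obtain i where i: "i \<in> I" "\<epsilon> * real (card S) < real (N i g)"
        using bad[OF \<open>g \<in> G\<close>] by blast
      have "8 ^ card S \<le> (C powr \<epsilon>) ^ card S"
        using C by (intro power_mono) auto
      also have "\<dots> = C powr (\<epsilon> * real (card S))"
        using C by (simp add: powr_powr flip: powr_realpow)
      also have "\<dots> \<le> C powr real (N i g)"
        using i C by (intro powr_mono) auto
      also have "\<dots> = C ^ N i g"
        using C by (simp add: powr_realpow)
      also have "\<dots> \<le> (\<Sum>i\<in>I. C ^ N i g)"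
        using fin i C by (intro member_le_sum) auto
      finally show ?thesis .
    qed
    \<comment> \<open>Here 8 = 4 * 2: the 4 beats the number of inputs, strictly because
      \<open>n < card S\<close>, and the 2 matches the moment bound.\<close>
    then have "(\<Sum>g\<in>G. 8 ^ card S) \<le> (\<Sum>g\<in>G. \<Sum>i\<in>I. C ^ N i g)"
      by (rule sum_mono)
    also have "\<dots> = (\<Sum>i\<in>I. \<Sum>g\<in>G. C ^ N i g)"
      by (rule sum.swap)
    also have "\<dots> \<le> (\<Sum>i\<in>I. (2 * real (card \<Omega>)) ^ card S)"
      by (intro sum_mono moment)
    also have "\<dots> \<le> 4 ^ n * (2 * real (card \<Omega>)) ^ card S"
      using I(1) of_nat_mono[OF I(1), where ?'a = real] by (simp add: mult_right_mono)
    also have "\<dots> < 4 ^ card S * (2 * real (card \<Omega>)) ^ card S"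
    proof (rule mult_strict_right_mono)
      show "(4::real) ^ n < 4 ^ card S" using I(2) by simp
      show "0 < (2 * real (card \<Omega>)) ^ card S" using fin by (simp add: card_gt_0_iff)
    qed
    also have "\<dots> = (8 * real (card \<Omega>)) ^ card S"
      unfolding power_mult_distrib[symmetric] by simp
    finally show False
      by (simp add: cardG power_mult_distrib mult.commute)
  qed
  moreover have "G \<subseteq> S \<rightarrow> \<Omega>" unfolding G_def by auto
  ultimately show ?thesis unfolding N_def by blast
qed

section \<open>The comparison protocol\<close>

text \<open>Bob's two bits report both test results, so both players can follow the path and every
  round costs \<open>2 * k + 2\<close> bits. Alice's last bit announces the comparison; a position
  past the end of \<open>x\<close> signals equality.\<close>

primrec search_tree :: "nat \<Rightarrow> nat \<Rightarrow> hash list \<Rightarrow> bool list \<Rightarrow> (bool list, bool list) ptree" where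
  "search_tree m k [] w =
     alice_sends 1 (\<lambda>_ x. [length x \<le> lo m w \<or> x ! lo m w]) (\<lambda>_. Halt)"
| "search_tree m k (h # hs) w =
     alice_sends (2 * k) (\<lambda>_ x. h (take (lo m w) x) @ h (take (lo m (True # w)) x)) (\<lambda>ma.
     bob_sends 2 (\<lambda>_ y. [take k ma = h (take (lo m w) y), drop k ma = h (take (lo m (True # w)) y)])
       (\<lambda>mb. search_tree m k hs (if mb ! 0 then mb ! 1 # w else tl w)))"

lemma bits_sent_search_tree:
  assumes "\<And>h u. h \<in> set hs \<Longrightarrow> length u \<le> n \<Longrightarrow> length (h u) = k" "length x = n" "length y = n"
  shows "length (bits_sent (search_tree m k hs w) rA rB x y) = length hs * (2 * k + 2) + 1
    \<and> last (bits_sent (search_tree m k hs w) rA rB x y)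
        = (n \<le> lo m (search m x y hs w) \<or> x ! lo m (search m x y hs w))"
  using assms(1)
proof (induction hs arbitrary: w)
  case Nil
  then show ?case using assms(2) by (simp add: bits_sent_alice_sends)
next
  case (Cons h hs)
  define w' where "w' = advance m x y h w"
  have len: "length (h (take i z)) = k" if "length z = n" for i z
    using Cons.prems[of h "take i z"] that by simp
  have "bits_sent (search_tree m k (h # hs) w) rA rB x y
    = (h (take (lo m w) x) @ h (take (lo m (True # w)) x))
      @ [h (take (lo m w) x) = h (take (lo m w) y),
         h (take (lo m (True # w)) x) = h (take (lo m (True # w)) y)]
      @ bits_sent (search_tree m k hs w') rA rB x y"
    using assms len
    by (simp add: bits_sent_alice_sends bits_sent_bob_sends w'_def advance_def del: lo.simps)
  moreover note Cons.IH[of w']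
  \<comment> \<open>Nonemptiness lets \<open>last\<close> pass through the append.\<close>
  moreover have "bits_sent (search_tree m k hs w') rA rB x y \<noteq> []"
    using Cons.IH[of w'] Cons.prems by auto
  ultimately show ?case
    using Cons.prems len assms by (simp add: w'_def del: lo.simps)
qed

text \<open>Since \<open>n < 2 ^ m\<close>, the threshold \<open>2 ^ m - 1\<close> used for equal
  strings is at least \<open>n\<close>, whereas a genuine difference lies below \<open>n\<close>;
  the two cases cannot be confused.\<close>

lemma agree_upto_exists:
  assumes "length x = n" "length y = n" "n < 2 ^ m"
  obtains d where "agree_upto m d x y" "bin_val y \<le> bin_val x \<longleftrightarrow> n \<le> d \<or> x ! d"
proof (cases "x = y")
  case True
  have "agree_upto m (2 ^ m - 1) x y"
    using True by (auto simp: agree_upto_def)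
  moreover have "n \<le> 2 ^ m - 1" using assms(3) by linarith
  ultimately show ?thesis using that True by blast
next
  case False
  then obtain d where d: "d < length x" "x ! d \<noteq> y ! d" "\<And>i. take i x = take i y \<longleftrightarrow> i \<le> d"
    using first_difference[of x y] assms by metis
  have "agree_upto m d x y"
    unfolding agree_upto_def using d assms by simp
  moreover have "bin_val y \<le> bin_val x \<longleftrightarrow> x ! d"
    using d assms by (intro bin_val_le_iff_first_difference) auto
  ultimately show ?thesis using that[of d] d assms by simp
qed

text \<open>With the seed uniform on \<open>S\<close>, the error probability is at most the fraction
  of seeds giving a wrong last bit.\<close>

lemma oot_model_of_comparison:
  assumes "finite S" "S \<noteq> {}"
    and "\<And>x y. x \<in> X \<Longrightarrow> y \<in> Y \<Longrightarrow>
      real (card {s \<in> S. last (bits_sent t s [] x y) \<noteq> (bin_val y \<le> bin_val x)}) \<le> \<epsilon> * real (card S)"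
  shows "oot_model X Y bin_MAX \<epsilon> (private_protocol (pmf_of_set S) t)"
  unfolding oot_model_def
proof (intro exI ballI)
  fix x y assume xy: "x \<in> X" "y \<in> Y"
  let ?\<pi> = "private_protocol (pmf_of_set S) t"
  let ?OA = "\<lambda>t _ _ x. if last t then Some x else None"
  let ?OB = "\<lambda>t _ _ y. if last t then None else Some y"
  let ?W = "{s \<in> S. last (bits_sent t s [] x y) \<noteq> (bin_val y \<le> bin_val x)}"
  let ?E = "{(r, rA, rB). (?OA (transcript ?\<pi> r rA rB x y) r rA x, ?OB (transcript ?\<pi> r rA rB x y) r rB y)
      \<in> {(Some (bin_MAX x y), None), (None, Some (bin_MAX x y))}}"
  let ?R = "(\<lambda>rA. ([], rA, [])) -` ?E"
  have S: "real (card S) > 0" using assms by (simp add: card_gt_0_iff)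
  have "S - ?W \<subseteq> S \<inter> ?R"
    by (auto simp: transcript_private_protocol bin_MAX_def)
  then have "card (S - ?W) \<le> card (S \<inter> ?R)"
    using assms by (intro card_mono) auto
  then have "real (card S) - real (card ?W) \<le> real (card (S \<inter> ?R))"
    using assms(1) by (subst (asm) card_Diff_subset) auto
  then have "(1 - \<epsilon>) * real (card S) \<le> real (card (S \<inter> ?R))"
    using assms(3)[OF xy] by (simp add: left_diff_distrib)
  then have "1 - \<epsilon> \<le> real (card (S \<inter> ?R)) / real (card S)"
    using S by (simp add: pos_le_divide_eq)
  also have "\<dots> = measure_pmf.prob (coins ?\<pi>) ?E"
    using assms by (simp add: coins_private_protocol measure_pmf_of_set)
  finally show "1 - \<epsilon> \<le> measure_pmf.prob (coins ?\<pi>) ?E" .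
qed

lemma comparison_protocol_exists:
  fixes \<epsilon> :: real
  assumes k: "8 \<le> (2 ^ k / 6) powr \<epsilon>" "6 \<le> (2::real) ^ k" and n: "n < 2 ^ m" "0 < m"
  obtains \<pi> :: "(bool list, bool list) protocol" where "private_coin \<pi>"
    "oot_model (bitstrings n) (bitstrings n) bin_MAX \<epsilon> \<pi>"
    "cost (bitstrings n) (bitstrings n) \<pi> = enat (m + (3 * m * (2 * k + 2) + 1))"
proof -
  \<comment> \<open>Extensional functions on the finitely many possible prefixes form a finite set,
    so uniform choice reduces to counting.\<close>
  define H where "H = {u :: bool list. length u \<le> n} \<rightarrow>\<^sub>E bitstrings k"
  define \<Omega> where "\<Omega> = lists_of H (3 * m)"
  define I where "I = bitstrings n \<times> bitstrings n"
  define B where "B = (\<lambda>(x, y). {hs \<in> \<Omega>. m < deceptions m x y hs []})"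
  define S where "S = bitstrings m"
  have finD: "finite {u :: bool list. length u \<le> n}"
    using finite_lists_length_le[of "UNIV :: bool set" n] by simp
  have finH: "finite H" and neH: "H \<noteq> {}"
    unfolding H_def using finD finite_bitstrings bitstrings_nonempty
    by (auto simp: PiE_eq_empty_iff intro: finite_PiE)
  have dec: "2 ^ k * card {h \<in> H. deceived m x y h w} \<le> 2 * card H"
    if "length x = n" "length y = n" for x y w
  proof (rule card_deceived[OF finH _ that])
    fix u v :: "bool list" assume "length u \<le> n" "length v \<le> n" "u \<noteq> v"
    then show "2 ^ k * card {h \<in> H. h u = h v} \<le> card H"
      using hash_collisions[OF finD finite_bitstrings, of u v k]
      by (simp add: H_def card_bitstrings)
  qed
  have "\<exists>g \<in> S \<rightarrow> \<Omega>. \<forall>i\<in>I. real (card {s \<in> S. g s \<in> B i}) \<le> \<epsilon> * real (card S)"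
  \<comment> \<open>The weight \<open>2 ^ k / 6\<close> is the reciprocal of the fraction of bad
    lists allowed by \<open>card_many_deceptions\<close> with K = \<open>2 ^ k\<close>.\<close>
  proof (rule seeds_exist[of \<Omega> S I B "2 ^ k / 6" \<epsilon> n])
    show "finite \<Omega>" unfolding \<Omega>_def lists_of_def by (rule finite_lists_length_eq[OF finH])
    have "card \<Omega> = card H ^ (3 * m)"
      unfolding \<Omega>_def lists_of_def by (rule card_lists_length_eq[OF finH])
    then show "\<Omega> \<noteq> {}" using finH neH by auto
    show "finite S" "finite I" by (simp_all add: S_def I_def finite_bitstrings)
    show "card I \<le> 4 ^ n"
      by (simp add: I_def card_cartesian_product card_bitstrings flip: power_mult_distrib)
    show "n < card S" using n by (simp add: S_def card_bitstrings)
    show "B i \<subseteq> \<Omega>" for i by (auto simp: B_def split: prod.splits)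
    show "1 \<le> (2 ^ k / 6 :: real)" using k by simp
    show "8 \<le> (2 ^ k / 6) powr \<epsilon>" by (rule k(1))
    show "2 ^ k / 6 * real (card (B i)) \<le> real (card \<Omega>)" if iI: "i \<in> I" for i
    proof -
      obtain x y where i: "i = (x, y)" "length x = n" "length y = n"
        using iI by (auto simp: I_def bitstrings_def)
      have "2 ^ k * card (B i) \<le> 6 * card \<Omega>"
        using card_many_deceptions[OF finH n(2) dec[OF i(2,3)]] i(1) by (simp add: B_def \<Omega>_def)
      then have "real (2 ^ k * card (B i)) \<le> real (6 * card \<Omega>)"
        by (rule of_nat_mono)
      then show ?thesis by simp
    qed
  qed
  then obtain g where g: "g \<in> S \<rightarrow> \<Omega>"
    "\<And>i. i \<in> I \<Longrightarrow> real (card {s \<in> S. g s \<in> B i}) \<le> \<epsilon> * real (card S)"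
    by blast
  \<comment> \<open>Alice's private string is itself the seed; the table \<open>g\<close> is built
    into the tree.\<close>
  define t where "t = alice_sends m (\<lambda>r _. r) (\<lambda>s. search_tree m k (g s) [])"
  define \<pi> where "\<pi> = private_protocol (pmf_of_set S) t"
  have hs: "length (g s) = 3 * m" "\<And>h u. h \<in> set (g s) \<Longrightarrow> length u \<le> n \<Longrightarrow> length (h u) = k"
    if "s \<in> S" for s
    using funcset_mem[OF g(1) that] by (auto simp: \<Omega>_def lists_of_def H_def bitstrings_def PiE_iff)
  have bits: "bits_sent t s rB x y = s @ bits_sent (search_tree m k (g s) []) s rB x y"
    if "s \<in> S" for s rB x y
    using that by (simp add: t_def bits_sent_alice_sends S_def bitstrings_def)
  have tree: "length (bits_sent (search_tree m k (g s) []) s rB x y) = 3 * m * (2 * k + 2) + 1"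
    "last (bits_sent (search_tree m k (g s) []) s rB x y)
       = (n \<le> lo m (search m x y (g s) []) \<or> x ! lo m (search m x y (g s) []))"
    if "s \<in> S" "length x = n" "length y = n" for s rB x y
    using bits_sent_search_tree[of "g s" n k x y m "[]" s rB] hs[OF that(1)] that by auto
  have S: "finite S" "S \<noteq> {}" by (simp_all add: S_def finite_bitstrings bitstrings_nonempty)
  have "oot_model (bitstrings n) (bitstrings n) bin_MAX \<epsilon> \<pi>"
    unfolding \<pi>_def
  proof (rule oot_model_of_comparison[OF S])
    fix x y assume xy: "x \<in> bitstrings n" "y \<in> bitstrings n"
    then have len: "length x = n" "length y = n" by (auto simp: bitstrings_def)
    obtain d where d: "agree_upto m d x y" "bin_val y \<le> bin_val x \<longleftrightarrow> n \<le> d \<or> x ! d"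
      using agree_upto_exists[OF len n(1)] .
    have "last (bits_sent t s [] x y) = (bin_val y \<le> bin_val x)" if s: "s \<in> S" "g s \<notin> B (x, y)" for s
    proof -
      have "lo m (search m x y (g s) []) = d"
        using s g(1) hs(1) by (intro lo_search[OF d(1)]) (auto simp: B_def not_less)
      moreover have "bits_sent (search_tree m k (g s) []) s [] x y \<noteq> []"
        using tree[OF s(1) len, of "[]"] by auto
      ultimately show ?thesis
        using tree[OF s(1) len, of "[]"] d(2)
        by (simp add: bits[OF s(1)])
    qed
    then have "card {s \<in> S. last (bits_sent t s [] x y) \<noteq> (bin_val y \<le> bin_val x)}
        \<le> card {s \<in> S. g s \<in> B (x, y)}"
      using S by (intro card_mono) auto
    also have "real \<dots> \<le> \<epsilon> * real (card S)"
      using xy by (intro g(2)) (simp add: I_def)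
    finally show "real (card {s \<in> S. last (bits_sent t s [] x y) \<noteq> (bin_val y \<le> bin_val x)})
        \<le> \<epsilon> * real (card S)"
      by simp
  qed
  moreover have "cost (bitstrings n) (bitstrings n) \<pi> = enat (m + (3 * m * (2 * k + 2) + 1))"
  proof (rule cost_const[OF bitstrings_nonempty bitstrings_nonempty])
    fix r rA rB x y
    assume "(r, rA, rB) \<in> set_pmf (coins \<pi>)" "x \<in> bitstrings n" "y \<in> bitstrings n"
    then have s: "rA \<in> S" and len: "length x = n" "length y = n"
      using S by (auto simp: \<pi>_def coins_private_protocol bitstrings_def)
    then have "length rA = m" by (simp add: S_def bitstrings_def)
    then show "length (transcript \<pi> r rA rB x y) = m + (3 * m * (2 * k + 2) + 1)"
      using tree[OF s len, of rB] hs(1)[OF s]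
      by (simp add: \<pi>_def transcript_private_protocol bits[OF s])
  qed
  ultimately show ?thesis
    using that[of \<pi>] by (simp add: \<pi>_def private_coin_private_protocol)
qed

section \<open>Asymptotic bounds\<close>

lemma R_oot_bin_MAX_le:
  fixes \<epsilon> :: real
  assumes "0 < \<epsilon>"
  shows "\<exists>C. \<forall>n\<ge>2. real (R_oot (bitstrings n) (bitstrings n) bin_MAX \<epsilon>) \<le> C * log 2 (real n)
    \<and> real (R_oot_priv (bitstrings n) (bitstrings n) bin_MAX \<epsilon>) \<le> C * log 2 (real n)"
proof -
  \<comment> \<open>The hash length depends on \<open>\<epsilon>\<close> only; this choice makes
    \<open>(2 ^ k / 6) powr \<epsilon>\<close> at least 8.\<close>
  obtain k where k: "6 * 8 powr (1 / \<epsilon>) < (2::real) ^ k"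
    using real_arch_pow[of 2 "6 * 8 powr (1 / \<epsilon>)"] by auto
  have "8 = (8 powr (1 / \<epsilon>)) powr \<epsilon>"
    using assms by (simp add: powr_powr)
  also have "\<dots> \<le> (2 ^ k / 6) powr \<epsilon>"
    using k assms by (intro powr_mono2) auto
  finally have k8: "8 \<le> (2 ^ k / 6) powr \<epsilon>" .
  have "(1::real) \<le> 8 powr (1 / \<epsilon>)"
    using assms by (intro ge_one_powr_ge_zero) auto
  then have k6: "6 \<le> (2::real) ^ k" using k by linarith
  \<comment> \<open>The summands bound the seed, the rounds and the final bit, per unit of
    \<open>l + 1\<close>.\<close>
  define c where "c = 1 + 3 * (2 * k + 2) + 1"
  have bound: "real (R_oot (bitstrings n) (bitstrings n) bin_MAX \<epsilon>) \<le> real (2 * c) * log 2 (real n)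
      \<and> real (R_oot_priv (bitstrings n) (bitstrings n) bin_MAX \<epsilon>) \<le> real (2 * c) * log 2 (real n)"
    if "2 \<le> n" for n
  proof -
    obtain l where l: "2 ^ l \<le> n" "n < 2 ^ (l + 1)"
      using ex_power_ivl1[of 2 n] \<open>2 \<le> n\<close> by auto
    have "l \<noteq> 0" using l \<open>2 \<le> n\<close> by (intro notI) simp
    obtain \<pi> :: "(bool list, bool list) protocol" where \<pi>: "private_coin \<pi>"
      "oot_model (bitstrings n) (bitstrings n) bin_MAX \<epsilon> \<pi>"
      "cost (bitstrings n) (bitstrings n) \<pi> = enat ((l + 1) + (3 * (l + 1) * (2 * k + 2) + 1))"
      by (rule comparison_protocol_exists[OF k8 k6 l(2)]) auto
    have "(l + 1) + (3 * (l + 1) * (2 * k + 2) + 1) \<le> (l + 1) * c"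
      by (simp add: c_def algebra_simps)
    \<comment> \<open>Since \<open>l\<close> is at least 1, \<open>l + 1\<close> is at most
      \<open>2 * l\<close>; this is where \<open>n\<close> has to be at least 2.\<close>
    also have "\<dots> \<le> (2 * l) * c"
      using \<open>l \<noteq> 0\<close> by (intro mult_right_mono) auto
    finally have "real ((l + 1) + (3 * (l + 1) * (2 * k + 2) + 1)) \<le> real (2 * l * c)"
      by (rule of_nat_mono)
    also have "\<dots> = real (2 * c) * real l" by simp
    also have "real l \<le> log 2 (real n)"
      using l(1) \<open>2 \<le> n\<close> of_nat_mono[OF l(1), where ?'a = real]
      by (simp add: le_log_iff powr_realpow)
    finally have cost: "real ((l + 1) + (3 * (l + 1) * (2 * k + 2) + 1)) \<le> real (2 * c) * log 2 (real n)"
      by (simp add: mult_left_mono)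
    have "R_oot (bitstrings n) (bitstrings n) bin_MAX \<epsilon> \<le> (l + 1) + (3 * (l + 1) * (2 * k + 2) + 1)"
      unfolding R_oot_def by (rule min_cost_le[of "oot_model _ _ _ _", OF \<pi>(2,3)])
    moreover have "R_oot_priv (bitstrings n) (bitstrings n) bin_MAX \<epsilon>
        \<le> (l + 1) + (3 * (l + 1) * (2 * k + 2) + 1)"
      unfolding R_oot_priv_def
      by (rule min_cost_le[of "\<lambda>\<pi>. private_coin \<pi> \<and> oot_model _ _ _ _ \<pi>", OF conjI[OF \<pi>(1,2)] \<pi>(3)])
    ultimately show ?thesis
      using cost by (meson of_nat_mono order_trans)
  qed
  then show ?thesis by blast
qed

theorem mainTheorem20:
  fixes \<epsilon> :: real
  assumes "0 < \<epsilon>" and "\<epsilon> < 1 / 2"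
  shows "(\<lambda>n. real (R_oot (bitstrings n) (bitstrings n) bin_MAX \<epsilon>)) \<in> O(\<lambda>n. log 2 (real n))
       \<and> (\<lambda>n. real (R_uni (bitstrings n) (bitstrings n) bin_MAX \<epsilon>)) \<in> \<Omega>(\<lambda>n. real n)
       \<and> (\<lambda>n. real (R_oot_priv (bitstrings n) (bitstrings n) bin_MAX \<epsilon>)) \<in> O(\<lambda>n. log 2 (real n))
       \<and> (\<lambda>n. real (R_uni_priv (bitstrings n) (bitstrings n) bin_MAX \<epsilon>)) \<in> \<Omega>(\<lambda>n. real n)"
proof -
  obtain C where C:
    "\<And>n. 2 \<le> n \<Longrightarrow> real (R_oot (bitstrings n) (bitstrings n) bin_MAX \<epsilon>) \<le> C * log 2 (real n)"
    "\<And>n. 2 \<le> n \<Longrightarrow> real (R_oot_priv (bitstrings n) (bitstrings n) bin_MAX \<epsilon>) \<le> C * log 2 (real n)"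
    using R_oot_bin_MAX_le[OF assms(1)] by blast
  have upper: "(\<lambda>n. real (R n)) \<in> O(\<lambda>n. log 2 (real n))"
    if "\<And>n. 2 \<le> n \<Longrightarrow> real (R n) \<le> C * log 2 (real n)" for R :: "nat \<Rightarrow> nat"
    by (rule bigoI[of _ C]) (use that in \<open>auto intro!: eventually_sequentiallyI[of 2]\<close>)
  have lower: "(\<lambda>n. real (R n)) \<in> \<Omega>(\<lambda>n. real n)" if "\<And>n. n - 2 \<le> R n" for R :: "nat \<Rightarrow> nat"
  proof (rule landau_omega.bigI[of "1 / 2"])
    show "eventually (\<lambda>n. norm (real (R n)) \<ge> 1 / 2 * norm (real n)) sequentially"
    \<comment> \<open>From 4 on, \<open>n - 2\<close> is at least n/2.\<close>
    proof (rule eventually_sequentiallyI[of 4])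
      fix n :: nat assume "4 \<le> n"
      then have "n \<le> 2 * R n" using that[of n] by linarith
      then show "norm (real (R n)) \<ge> 1 / 2 * norm (real n)" by simp
    qed
  qed simp
  show ?thesis
    by (intro conjI upper lower C R_uni_bin_MAX_ge[OF assms])
qed

end
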